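(* Each element of the comeager conjugacy class of $\mathcal H(\{0,1\}^{\mathbb N})$ has the shadowing property.
   Context: $\{0,1\}^{\mathbb N}$ ($\mathbb N$ the positive integers) has the product topology and the metric $d(\sigma,\tau)=1/n$, where $n$ is the least positive integer with $\sigma(n)\neq\tau(n)$, and $d(\sigma,\sigma)=0$. $\mathcal H(\{0,1\}^{\mathbb N})$ is the group of all homeomorphisms of $\{0,1\}^{\mathbb N}$ onto itself, with the topology given by the metric $\tilde d(f,g)=\max_\sigma d(f(\sigma),g(\sigma))$. This group has a conjugacy class that is a comeager subset (necessarily unique), called the comeager conjugacy class of $\mathcal H(\{0,1\}^{\mathbb N})$. Let $h:X\to X$ be a homeomorphism of a metric space $X$. A sequence $(x_n)_{n\in\mathbb Z}$ in $X$ is a $\delta$-pseudotrajectory ($\delta>0$) of $h$ if $d(h(x_n),x_{n+1})\le\delta$ for every $n\in\mathbb Z$. The map $h$ has the shadowing property if for every $\epsilon>0$ there exists $\delta>0$ such that for every $\delta$-pseudotrajectory $(x_n)_{n\in\mathbb Z}$ of $h$ there exists $x\in X$ with $d(x_n,h^n(x))<\epsilon$ for every $n\in\mathbb Z$. *)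

theory Defs
  imports "HOL-Analysis.Analysis" "HOL-Algebra.Group"
begin

section \<open>The Cantor space\<close>

text \<open>
  Points are functions \<^typ>\<open>nat \<Rightarrow> bool\<close>, where index \<open>n\<close> stands for the position \<open>n + 1\<close> of a
  sequence indexed by the positive integers; hence the \<open>Suc\<close> in the distance.
\<close>

definition cantor_topology :: "(nat \<Rightarrow> bool) topology" where
  "cantor_topology = product_topology (\<lambda>_. discrete_topology UNIV) UNIV"

definition cantor_dist :: "(nat \<Rightarrow> bool) \<Rightarrow> (nat \<Rightarrow> bool) \<Rightarrow> real" where
  "cantor_dist \<sigma> \<tau> = (if \<sigma> = \<tau> then 0 else 1 / real (Suc (LEAST n. \<sigma> n \<noteq> \<tau> n)))"

lemma cantor_dist_less_iff:
  "cantor_dist \<sigma> \<tau> < 1 / real (Suc n) \<longleftrightarrow> (\<forall>k\<le>n. \<sigma> k = \<tau> k)"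
proof (cases "\<sigma> = \<tau>")
  case True
  then show ?thesis by (simp add: cantor_dist_def)
next
  case False
  let ?m = "LEAST n. \<sigma> n \<noteq> \<tau> n"
  have "\<exists>n. \<sigma> n \<noteq> \<tau> n" using False by auto
  then have m: "\<sigma> ?m \<noteq> \<tau> ?m" by (rule LeastI_ex)
  have least: "\<And>k. k < ?m \<Longrightarrow> \<sigma> k = \<tau> k" using not_less_Least by blast
  have "cantor_dist \<sigma> \<tau> < 1 / real (Suc n) \<longleftrightarrow> n < ?m"
    using False by (simp add: cantor_dist_def divide_simps)
  also have "\<dots> \<longleftrightarrow> (\<forall>k\<le>n. \<sigma> k = \<tau> k)"
    using m least by (meson le_less_trans not_less)
  finally show ?thesis .
qed

lemma cantor_dist_cases: "cantor_dist \<sigma> \<tau> = 0 \<or> (\<exists>n. cantor_dist \<sigma> \<tau> = 1 / real (Suc n))"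
  by (auto simp: cantor_dist_def)

lemma cantor_dist_nonneg: "0 \<le> cantor_dist \<sigma> \<tau>"
  by (simp add: cantor_dist_def)

lemma cantor_dist_le_1: "cantor_dist \<sigma> \<tau> \<le> 1"
  by (simp add: cantor_dist_def)

lemma cantor_dist_le_max: "cantor_dist \<sigma> \<rho> \<le> max (cantor_dist \<sigma> \<tau>) (cantor_dist \<tau> \<rho>)"
proof (rule ccontr)
  assume "\<not> ?thesis"
  then have less: "cantor_dist \<sigma> \<tau> < cantor_dist \<sigma> \<rho>" "cantor_dist \<tau> \<rho> < cantor_dist \<sigma> \<rho>" by auto
  then obtain n where n: "cantor_dist \<sigma> \<rho> = 1 / real (Suc n)"
    using cantor_dist_cases[of \<sigma> \<rho>] cantor_dist_nonneg[of \<sigma> \<tau>] by force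
  have "\<forall>k\<le>n. \<sigma> k = \<tau> k" "\<forall>k\<le>n. \<tau> k = \<rho> k"
    using less unfolding n cantor_dist_less_iff by blast+
  then have "cantor_dist \<sigma> \<rho> < 1 / real (Suc n)"
    unfolding cantor_dist_less_iff by simp
  then show False using n by simp
qed

interpretation Cantor: Metric_space UNIV cantor_dist
proof
  show "0 \<le> cantor_dist x y" for x y by (rule cantor_dist_nonneg)
  show "cantor_dist x y = cantor_dist y x" for x y
  proof -
    have "(\<lambda>n. x n \<noteq> y n) = (\<lambda>n. y n \<noteq> x n)" by blast
    then show ?thesis unfolding cantor_dist_def by auto
  qed
  show "cantor_dist x y = 0 \<longleftrightarrow> x = y" for x y
    by (simp add: cantor_dist_def)
  show "cantor_dist x z \<le> cantor_dist x y + cantor_dist y z" for x y z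
    using cantor_dist_le_max[of x z y] cantor_dist_nonneg[of x y] cantor_dist_nonneg[of y z] by linarith
qed

lemma cantor_mtopology: "Cantor.mtopology = cantor_topology"
proof (rule topology_eq[THEN iffD2], rule allI, rule iffI)
  fix U
  assume U: "openin Cantor.mtopology U"
  have "\<exists>X. x \<in> Pi\<^sub>E UNIV X \<and> (\<forall>i. openin (discrete_topology UNIV) (X i)) \<and>
      finite {i. X i \<noteq> topspace (discrete_topology (UNIV :: bool set))} \<and> Pi\<^sub>E UNIV X \<subseteq> U"
    if xU: "x \<in> U" for x
  proof -
    obtain r where r: "r > 0" "Cantor.mball x r \<subseteq> U"
      using U xU unfolding Cantor.openin_mtopology by blast
    obtain n where n: "1 / real (Suc n) < r"
      using r(1) by (rule nat_approx_posE)
    let ?X = "\<lambda>i. if i \<le> n then {x i} else UNIV"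
    have "Pi\<^sub>E UNIV ?X \<subseteq> U"
    proof
      fix y assume "y \<in> Pi\<^sub>E UNIV ?X"
      then have "\<forall>k\<le>n. x k = y k" by (auto simp: PiE_iff split: if_splits)
      then have "cantor_dist x y < r" using n cantor_dist_less_iff[of x y n] less_trans by blast
      then show "y \<in> U" using r(2) by auto
    qed
    moreover have "finite {i. ?X i \<noteq> topspace (discrete_topology UNIV)}"
      by (rule finite_subset[of _ "{..n}"]) auto
    ultimately show ?thesis by (intro exI[of _ ?X]) auto
  qed
  then show "openin cantor_topology U"
    unfolding cantor_topology_def openin_product_topology_alt by (auto simp: conj_ac)
next
  fix U
  assume U: "openin cantor_topology U"
  show "openin Cantor.mtopology U"
    unfolding Cantor.openin_mtopology
  proof (intro conjI allI impI)
    fix x assume "x \<in> U"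
    then obtain X where X: "finite {i. X i \<noteq> (UNIV :: bool set)}" "x \<in> Pi\<^sub>E UNIV X" "Pi\<^sub>E UNIV X \<subseteq> U"
      using U unfolding cantor_topology_def openin_product_topology_alt by auto
    obtain n where n: "\<forall>i\<in>{i. X i \<noteq> UNIV}. i \<le> n"
      using X(1) finite_nat_set_iff_bounded_le by blast
    have "Cantor.mball x (1 / real (Suc n)) \<subseteq> U"
    proof
      fix y assume "y \<in> Cantor.mball x (1 / real (Suc n))"
      then have eq: "\<forall>k\<le>n. x k = y k" using cantor_dist_less_iff by auto
      have "y i \<in> X i" for i
      proof (cases "i \<le> n")
        case True
        then have "x i = y i" using eq by blast
        moreover have "x i \<in> X i" using X(2) by (rule PiE_mem) simp
        ultimately show ?thesis by (simp only:)
      next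
        case False
        then have "X i = UNIV" using n by blast
        then show ?thesis by (simp only: UNIV_I)
      qed
      then show "y \<in> U" using X(3) by auto
    qed
    then show "\<exists>r>0. Cantor.mball x r \<subseteq> U" by (intro exI[of _ "1 / real (Suc n)"]) simp
  qed simp
qed


section \<open>The homeomorphism group\<close>

definition cantor_homeo_group :: "((nat \<Rightarrow> bool) \<Rightarrow> (nat \<Rightarrow> bool)) monoid" where
  "cantor_homeo_group =
    \<lparr>carrier = {f. homeomorphic_map cantor_topology cantor_topology f}, mult = (\<circ>), one = id\<rparr>"

lemma group_cantor_homeo_group: "group cantor_homeo_group"
proof (rule groupI)
  fix f assume "f \<in> carrier cantor_homeo_group"
  then obtain g where "homeomorphic_maps cantor_topology cantor_topology f g"
    by (auto simp: cantor_homeo_group_def homeomorphic_map_maps)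
  then show "\<exists>g\<in>carrier cantor_homeo_group. g \<otimes>\<^bsub>cantor_homeo_group\<^esub> f = \<one>\<^bsub>cantor_homeo_group\<^esub>"
    by (intro bexI[of _ g])
      (auto simp: cantor_homeo_group_def homeomorphic_maps_def homeomorphic_map_maps
        cantor_topology_def fun_eq_iff)
qed (auto simp: cantor_homeo_group_def homeomorphic_map_compose comp_assoc)

text \<open>
  The uniform distance. The supremum is a maximum, see \<open>cantor_sup_dist_attained\<close> below.
\<close>

definition cantor_sup_dist ::
    "((nat \<Rightarrow> bool) \<Rightarrow> (nat \<Rightarrow> bool)) \<Rightarrow> ((nat \<Rightarrow> bool) \<Rightarrow> (nat \<Rightarrow> bool)) \<Rightarrow> real" where
  "cantor_sup_dist f g = (SUP \<sigma>. cantor_dist (f \<sigma>) (g \<sigma>))"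

lemma cantor_sup_dist_upper: "cantor_dist (f \<sigma>) (g \<sigma>) \<le> cantor_sup_dist f g"
  unfolding cantor_sup_dist_def
  by (rule cSUP_upper) (auto intro!: bdd_aboveI[where M = 1] cantor_dist_le_1)

lemma cantor_sup_dist_attained: "\<exists>\<sigma>. cantor_sup_dist f g = cantor_dist (f \<sigma>) (g \<sigma>)"
proof (cases "f = g")
  case True
  then show ?thesis by (simp add: cantor_sup_dist_def cantor_dist_def)
next
  case False
  let ?P = "\<lambda>n. \<exists>\<sigma>. f \<sigma> n \<noteq> g \<sigma> n"
  have "\<exists>n. ?P n" using False by (auto simp: fun_eq_iff)
  then have "?P (LEAST n. ?P n)" by (rule LeastI_ex)
  then obtain \<sigma> where \<sigma>: "f \<sigma> (LEAST n. ?P n) \<noteq> g \<sigma> (LEAST n. ?P n)" by blast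
  define m where "m = (LEAST n. ?P n)"
  have below: "f \<tau> k = g \<tau> k" if "k < m" for \<tau> k using not_less_Least[of k ?P] that m_def by blast
  have "cantor_dist (f \<tau>) (g \<tau>) \<le> cantor_dist (f \<sigma>) (g \<sigma>)" for \<tau>
  proof -
    have "\<not> cantor_dist (f \<sigma>) (g \<sigma>) < 1 / real (Suc m)"
      using \<sigma> unfolding cantor_dist_less_iff m_def by blast
    moreover have "cantor_dist (f \<tau>) (g \<tau>) \<le> 1 / real (Suc m)"
    proof (cases m)
      case 0
      then show ?thesis using cantor_dist_le_1 by simp
    next
      case (Suc j)
      then have lt: "cantor_dist (f \<tau>) (g \<tau>) < 1 / real m"
        using below[of _ \<tau>] cantor_dist_less_iff[of "f \<tau>" "g \<tau>" j] by simp
      show ?thesis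
        using cantor_dist_cases[of "f \<tau>" "g \<tau>"]
      proof
        assume "\<exists>n. cantor_dist (f \<tau>) (g \<tau>) = 1 / real (Suc n)"
        then obtain n where n: "cantor_dist (f \<tau>) (g \<tau>) = 1 / real (Suc n)" by blast
        have "m < Suc n" using lt Suc unfolding n by (simp add: divide_simps split: if_splits)
        then show ?thesis unfolding n by (simp add: divide_simps)
      qed simp
    qed
    ultimately show ?thesis by linarith
  qed
  then have "cantor_sup_dist f g \<le> cantor_dist (f \<sigma>) (g \<sigma>)"
    unfolding cantor_sup_dist_def by (intro cSUP_least) auto
  then show ?thesis using cantor_sup_dist_upper[of f \<sigma> g] by (intro exI[of _ \<sigma>]) linarith
qed

interpretation Homeo: Metric_space "carrier cantor_homeo_group" cantor_sup_dist
proof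
  show "0 \<le> cantor_sup_dist f g" for f g
    using cantor_sup_dist_upper[of f undefined g] cantor_dist_nonneg order_trans by blast
  show "cantor_sup_dist f g = cantor_sup_dist g f" for f g
    unfolding cantor_sup_dist_def by (simp add: Cantor.commute)
  show "cantor_sup_dist f g = 0 \<longleftrightarrow> f = g" for f g
  proof
    assume "cantor_sup_dist f g = 0"
    then have "cantor_dist (f \<sigma>) (g \<sigma>) = 0" for \<sigma>
      using cantor_sup_dist_upper[of f \<sigma> g] cantor_dist_nonneg[of "f \<sigma>" "g \<sigma>"] by linarith
    then show "f = g" by auto
  qed (simp add: cantor_sup_dist_def)
  show "cantor_sup_dist f h \<le> cantor_sup_dist f g + cantor_sup_dist g h" for f g h
  proof -
    obtain \<sigma> where "cantor_sup_dist f h = cantor_dist (f \<sigma>) (h \<sigma>)"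
      using cantor_sup_dist_attained by blast
    then show ?thesis
      using Cantor.triangle[of "f \<sigma>" "g \<sigma>" "h \<sigma>"] cantor_sup_dist_upper[of f \<sigma> g]
        cantor_sup_dist_upper[of g \<sigma> h] by simp
  qed
qed


section \<open>Comeager sets and conjugacy classes\<close>

definition nowhere_dense_in :: "'a topology \<Rightarrow> 'a set \<Rightarrow> bool" where
  "nowhere_dense_in X S \<longleftrightarrow> S \<subseteq> topspace X \<and> X interior_of Abstract_Topology.closure_of X S = {}"

definition meager_in :: "'a topology \<Rightarrow> 'a set \<Rightarrow> bool" where
  "meager_in X S \<longleftrightarrow> (\<exists>N :: nat \<Rightarrow> 'a set. (\<forall>n. nowhere_dense_in X (N n)) \<and> S = (\<Union>n. N n))"

definition comeager_in :: "'a topology \<Rightarrow> 'a set \<Rightarrow> bool" where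
  "comeager_in X S \<longleftrightarrow> S \<subseteq> topspace X \<and> meager_in X (topspace X - S)"

definition conjugacy_classes :: "('a, 'b) monoid_scheme \<Rightarrow> 'a set set" where
  "conjugacy_classes G =
    {{k \<otimes>\<^bsub>G\<^esub> a \<otimes>\<^bsub>G\<^esub> inv\<^bsub>G\<^esub> k | k. k \<in> carrier G} | a. a \<in> carrier G}"


section \<open>Shadowing\<close>

text \<open>The iterate \<open>h\<^sup>n\<close> of a bijection \<open>h\<close> of \<open>M\<close>, for an integer \<open>n\<close>.\<close>

definition int_iterate :: "'a set \<Rightarrow> ('a \<Rightarrow> 'a) \<Rightarrow> int \<Rightarrow> 'a \<Rightarrow> 'a" where
  "int_iterate M h n = (if n \<ge> 0 then h ^^ nat n else inv_into M h ^^ nat (- n))"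

context Metric_space
begin

definition pseudotrajectory :: "('a \<Rightarrow> 'a) \<Rightarrow> real \<Rightarrow> (int \<Rightarrow> 'a) \<Rightarrow> bool" where
  "pseudotrajectory h \<delta> x \<longleftrightarrow> range x \<subseteq> M \<and> (\<forall>n. d (h (x n)) (x (n + 1)) \<le> \<delta>)"

definition shadowing_property :: "('a \<Rightarrow> 'a) \<Rightarrow> bool" where
  "shadowing_property h \<longleftrightarrow>
    (\<forall>\<epsilon>>0. \<exists>\<delta>>0. \<forall>x. pseudotrajectory h \<delta> x \<longrightarrow>
      (\<exists>y\<in>M. \<forall>n. d (x n) (int_iterate M h n y) < \<epsilon>))"

end

end

theory Submission
  imports Defs
begin

text \<open>
  The idea is to find a property of homeomorphisms that implies shadowing, is open, and can be reached
  from any homeomorphism by an arbitrarily small change. A homeomorphism \<open>h\<close> with a one-way split at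
  precision \<open>N\<close> (\<open>one_way_split\<close>) has a clopen set \<open>U\<close>, mapped into itself, such that the first \<open>N\<close>
  coordinates of a point of \<open>U\<close> determine those of its image, and the first \<open>N\<close> coordinates of a point
  outside \<open>U\<close> determine those of its preimage.

  Such a map shadows at precision \<open>N\<close> (\<open>traceable_if_one_way_split\<close>). A pseudotrajectory with small
  errors also crosses the boundary of \<open>U\<close> at most once, and only inwards. The orbit through the point where
  it enters has the same coarse future, because the map is deterministic in \<open>U\<close>, and the same coarse
  past, because its inverse is deterministic outside. If the pseudotrajectory never enters \<open>U\<close> or has
  always been there, the orbit is a limit of orbits that trace longer and longer windows.

  Having a one-way split is stable under small perturbations (\<open>one_way_split_stable\<close>). It can be
  created by a perturbation that keeps the first \<open>N\<close> coordinates of all values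
  (\<open>one_way_split_dense\<close>), because nonempty clopen sets are homeomorphic to each other, so that the
  pieces of the partition can be rearranged at will (\<open>homeo_matching_labels\<close>). Hence the maps with
  one-way splits at arbitrarily high precision form a countable intersection of dense open sets. The
  homeomorphism group is completely metrizable, so by the Baire category theorem this intersection
  meets every comeager set (\<open>comeager_meets_open_dense\<close>). The comeager conjugacy class therefore has
  an element with the shadowing property, and shadowing is invariant under conjugation
  (\<open>shadowing_conjugate\<close>).
\<close>

section \<open>Agreement up to a finite coordinate\<close>

definition agree :: "nat \<Rightarrow> (nat \<Rightarrow> bool) \<Rightarrow> (nat \<Rightarrow> bool) \<Rightarrow> bool" where
  "agree n x y \<longleftrightarrow> (\<forall>k<n. x k = y k)"

lemma agree_refl [simp]: "agree n x x"
  by (simp add: agree_def)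

lemma agree_sym: "agree n x y \<Longrightarrow> agree n y x"
  by (simp add: agree_def)

lemma agree_trans [trans]: "agree n x y \<Longrightarrow> agree n y z \<Longrightarrow> agree n x z"
  by (simp add: agree_def)

lemma agree_cong: "agree n x x' \<Longrightarrow> agree n y y' \<Longrightarrow> agree n x y \<longleftrightarrow> agree n x' y'"
  by (simp add: agree_def)

lemma agree_mono: "agree n x y \<Longrightarrow> m \<le> n \<Longrightarrow> agree m x y"
  by (simp add: agree_def)

lemma cantor_dist_less_iff_agree: "cantor_dist x y < 1 / real (Suc n) \<longleftrightarrow> agree (Suc n) x y"
  by (simp only: cantor_dist_less_iff agree_def less_Suc_eq_le)

lemma eq_if_agree: "(\<And>n. agree n x y) \<Longrightarrow> x = y"
  by (auto simp: agree_def fun_eq_iff)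

lemma cantor_sup_dist_less_iff_agree:
  "cantor_sup_dist f g < 1 / real (Suc n) \<longleftrightarrow> (\<forall>x. agree (Suc n) (f x) (g x))"
proof -
  have "cantor_sup_dist f g < 1 / real (Suc n) \<longleftrightarrow> (\<forall>x. cantor_dist (f x) (g x) < 1 / real (Suc n))"
    using cantor_sup_dist_attained[of f g] cantor_sup_dist_upper[of f _ g]
    by (metis le_less_trans)
  then show ?thesis by (simp only: cantor_dist_less_iff_agree)
qed

text \<open>
  Uniform continuity on \<open>A\<close>: since the balls of the Cantor metric are the cylinders, finitely many
  coordinates of the argument determine finitely many coordinates of the value.
\<close>

definition ucont :: "(nat \<Rightarrow> bool) set \<Rightarrow> ((nat \<Rightarrow> bool) \<Rightarrow> (nat \<Rightarrow> bool)) \<Rightarrow> bool" where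
  "ucont A f \<longleftrightarrow> (\<forall>n. \<exists>m. \<forall>x\<in>A. \<forall>y\<in>A. agree m x y \<longrightarrow> agree n (f x) (f y))"

lemma ucontD:
  assumes "ucont UNIV f"
  obtains m where "\<And>x y. agree m x y \<Longrightarrow> agree n (f x) (f y)"
  using assms unfolding ucont_def by blast

lemma ucont_comp:
  assumes "ucont A f" "ucont B g" "f ` A \<subseteq> B"
  shows "ucont A (g \<circ> f)"
  using assms unfolding ucont_def by (simp add: image_subset_iff) meson

lemma compact_cantor_topology: "compact_space cantor_topology"
  by (simp add: cantor_topology_def compact_space_product_topology compact_space_discrete_topology)

text \<open>
  Compactness turns continuity into uniform continuity, so that from here on homeomorphisms can be
  handled through moduli of agreement alone.
\<close>

lemma ucont_iff_continuous_map:
  "ucont UNIV f \<longleftrightarrow> continuous_map cantor_topology cantor_topology f"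
proof
  assume f: "ucont UNIV f"
  show "continuous_map cantor_topology cantor_topology f"
    unfolding cantor_mtopology[symmetric] Cantor.metric_continuous_map[OF Cantor.Metric_space_axioms]
  proof (intro conjI ballI allI impI)
    fix a and \<epsilon> :: real assume "\<epsilon> > 0"
    then obtain n where n: "1 / real (Suc n) < \<epsilon>" by (rule nat_approx_posE)
    obtain m where m: "\<And>x y. agree m x y \<Longrightarrow> agree (Suc n) (f x) (f y)"
      using ucontD[OF f] by metis
    have "cantor_dist (f a) (f x) < \<epsilon>" if "cantor_dist a x < 1 / real (Suc m)" for x
      using that n m[of a x] agree_mono[of "Suc m" a x m]
      unfolding cantor_dist_less_iff_agree[symmetric] by (meson le_SucI less_trans order_refl)
    then show "\<exists>\<delta>>0. \<forall>x. x \<in> UNIV \<and> cantor_dist a x < \<delta> \<longrightarrow> cantor_dist (f a) (f x) < \<epsilon>"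
      by (intro exI[of _ "1 / real (Suc m)"]) auto
  qed auto
next
  assume f: "continuous_map cantor_topology cantor_topology f"
  let ?m = "metric (UNIV, cantor_dist)"
  have "uniformly_continuous_map ?m ?m f"
    using f compact_cantor_topology
    by (intro continuous_imp_uniformly_continuous_map) (simp add: cantor_mtopology)
  then have uc: "\<forall>\<epsilon>>0. \<exists>\<delta>>0. \<forall>x y. cantor_dist y x < \<delta> \<longrightarrow> cantor_dist (f y) (f x) < \<epsilon>"
    unfolding uniformly_continuous_map_def by simp
  show "ucont UNIV f"
    unfolding ucont_def
  proof
    fix n
    obtain \<delta> where \<delta>: "\<delta> > 0" "\<And>x y. cantor_dist y x < \<delta> \<Longrightarrow> cantor_dist (f y) (f x) < 1 / real (Suc n)"
      using uc[rule_format, of "1 / real (Suc n)"] by auto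
    obtain m where m: "1 / real (Suc m) < \<delta>" using \<delta>(1) by (rule nat_approx_posE)
    have "agree n (f x) (f y)" if "agree (Suc m) x y" for x y
      using that \<delta>(2)[of x y] m agree_mono[of "Suc n" "f x" "f y" n]
      unfolding cantor_dist_less_iff_agree[symmetric] by auto
    then show "\<exists>m. \<forall>x\<in>UNIV. \<forall>y\<in>UNIV. agree m x y \<longrightarrow> agree n (f x) (f y)" by blast
  qed
qed

lemma carrier_cantor_homeo_group:
  "f \<in> carrier cantor_homeo_group \<longleftrightarrow> bij f \<and> ucont UNIV f \<and> ucont UNIV (inv_into UNIV f)"
proof
  assume "f \<in> carrier cantor_homeo_group"
  then obtain g where g: "homeomorphic_maps cantor_topology cantor_topology f g"
    by (auto simp: cantor_homeo_group_def homeomorphic_map_maps)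
  then have gf: "\<And>x. g (f x) = x" "\<And>x. f (g x) = x" and uc: "ucont UNIV f" "ucont UNIV g"
    by (auto simp: homeomorphic_maps_def cantor_topology_def ucont_iff_continuous_map)
  have "bij f" by (rule o_bij[of g]) (auto simp: gf fun_eq_iff)
  moreover have "inv_into UNIV f = g" by (rule inv_equality) (auto simp: gf)
  ultimately show "bij f \<and> ucont UNIV f \<and> ucont UNIV (inv_into UNIV f)" using uc by simp
next
  assume "bij f \<and> ucont UNIV f \<and> ucont UNIV (inv_into UNIV f)"
  then have "homeomorphic_maps cantor_topology cantor_topology f (inv_into UNIV f)"
    by (simp add: homeomorphic_maps_def ucont_iff_continuous_map bij_is_inj bij_is_surj surj_f_inv_f)
  then show "f \<in> carrier cantor_homeo_group"
    by (auto simp: cantor_homeo_group_def homeomorphic_map_maps)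
qed

lemma homeoI:
  assumes "\<And>x. g (f x) = x" "\<And>x. f (g x) = x" "ucont UNIV f" "ucont UNIV g"
  shows "f \<in> carrier cantor_homeo_group" "inv_into UNIV f = g"
proof -
  have "bij f" by (rule o_bij[of g]) (auto simp: assms fun_eq_iff)
  moreover show "inv_into UNIV f = g" by (rule inv_equality) (auto simp: assms)
  ultimately show "f \<in> carrier cantor_homeo_group"
    using assms by (simp add: carrier_cantor_homeo_group)
qed

lemma homeo_inv:
  assumes "f \<in> carrier cantor_homeo_group"
  shows "inv_into UNIV f (f x) = x" "f (inv_into UNIV f x) = x"
  using assms by (simp_all add: carrier_cantor_homeo_group bij_is_inj bij_is_surj surj_f_inv_f)

lemma homeo_inv_closed:
  "f \<in> carrier cantor_homeo_group \<Longrightarrow> inv_into UNIV f \<in> carrier cantor_homeo_group"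
  by (simp add: carrier_cantor_homeo_group bij_imp_bij_inv inv_inv_eq)

lemma homeo_comp_closed:
  "f \<in> carrier cantor_homeo_group \<Longrightarrow> g \<in> carrier cantor_homeo_group \<Longrightarrow>
    f \<circ> g \<in> carrier cantor_homeo_group"
  by (auto simp: cantor_homeo_group_def homeomorphic_map_compose)

lemma homeo_group_inv:
  assumes "f \<in> carrier cantor_homeo_group"
  shows "inv\<^bsub>cantor_homeo_group\<^esub> f = inv_into UNIV f"
proof -
  interpret group cantor_homeo_group by (rule group_cantor_homeo_group)
  have "inv_into UNIV f \<otimes>\<^bsub>cantor_homeo_group\<^esub> f = \<one>\<^bsub>cantor_homeo_group\<^esub>"
    using homeo_inv[OF assms] by (simp add: cantor_homeo_group_def fun_eq_iff)
  then show ?thesis using inv_equality assms homeo_inv_closed by blast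
qed

lemma ucont_funpow: "ucont UNIV f \<Longrightarrow> ucont UNIV (f ^^ n)"
proof (induction n)
  case 0
  then show ?case by (auto simp: ucont_def)
next
  case (Suc n)
  then show ?case by (simp only: funpow.simps) (rule ucont_comp[where B = UNIV]; simp)
qed

section \<open>Homeomorphisms with prescribed labels\<close>

definition locconst :: "((nat \<Rightarrow> bool) \<Rightarrow> 'a) \<Rightarrow> bool" where
  "locconst c \<longleftrightarrow> (\<exists>m. \<forall>x y. agree m x y \<longrightarrow> c x = c y)"

definition word :: "nat \<Rightarrow> (nat \<Rightarrow> bool) \<Rightarrow> (nat \<Rightarrow> bool)" where
  "word n x = (\<lambda>k. k < n \<and> x k)"

lemma word_eq_iff: "word n x = word n y \<longleftrightarrow> agree n x y"
  by (auto simp: word_def agree_def fun_eq_iff)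

lemma agree_word: "agree n (word n x) x"
  by (simp add: agree_def word_def)

lemma finite_range_word: "finite (range (word n))"
proof (rule finite_subset)
  show "range (word n) \<subseteq> (\<lambda>S k. k \<in> S) ` Pow {..<n}"
  proof
    fix w assume "w \<in> range (word n)"
    then obtain x where "w = word n x" by blast
    then have "w = (\<lambda>k. k \<in> {k. k < n \<and> x k})" by (simp add: word_def)
    then show "w \<in> (\<lambda>S k. k \<in> S) ` Pow {..<n}" by blast
  qed
qed simp

lemma finite_range_locconst:
  assumes "locconst c" shows "finite (range c)"
proof -
  obtain m where m: "\<And>x y. agree m x y \<Longrightarrow> c x = c y" using assms by (auto simp: locconst_def)
  have "range c \<subseteq> c ` range (word m)" using m[OF agree_word] by (metis image_eqI image_subset_iff rangeI)
  then show ?thesis using finite_range_word finite_surj by blast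
qed

text \<open>
  The set \<open>A\<close> is homeomorphic to the whole Cantor space. The two directions of the homeomorphism are
  recorded with their uniform continuity, which is what the gluing of homeomorphisms consumes.
\<close>

definition cantor_like :: "(nat \<Rightarrow> bool) set \<Rightarrow> bool" where
  "cantor_like A \<longleftrightarrow> (\<exists>f g. ucont UNIV f \<and> ucont A g \<and> range f \<subseteq> A \<and>
     (\<forall>x. g (f x) = x) \<and> (\<forall>x\<in>A. f (g x) = x))"

lemma cantor_likeE:
  assumes "cantor_like A"
  obtains f g where "ucont UNIV f" "ucont A g" "range f \<subseteq> A"
    "\<And>x. g (f x) = x" "\<And>x. x \<in> A \<Longrightarrow> f (g x) = x"
proof -
  from assms[unfolded cantor_like_def] obtain f g where "ucont UNIV f \<and> ucont A g \<and> range f \<subseteq> A \<and>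
     (\<forall>x. g (f x) = x) \<and> (\<forall>x\<in>A. f (g x) = x)"
    by (elim exE)
  then show thesis by (intro that[of f g]) auto
qed

definition scons :: "bool \<Rightarrow> (nat \<Rightarrow> bool) \<Rightarrow> (nat \<Rightarrow> bool)" where
  "scons b x = case_nat b x"

definition stail :: "(nat \<Rightarrow> bool) \<Rightarrow> (nat \<Rightarrow> bool)" where
  "stail x = (\<lambda>k. x (Suc k))"

lemma scons_simps [simp]: "scons b x 0 = b" "stail (scons b x) = x" "scons (x 0) (stail x) = x"
  by (auto simp: scons_def stail_def fun_eq_iff split: nat.split)

lemma agree_scons [simp]: "agree (Suc n) (scons b x) (scons b' y) \<longleftrightarrow> b = b' \<and> agree n x y"
  by (auto simp: agree_def scons_def less_Suc_eq_0_disj)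

lemma agree_Suc_iff: "agree (Suc n) x y \<longleftrightarrow> x 0 = y 0 \<and> agree n (stail x) (stail y)"
  by (auto simp: agree_def stail_def less_Suc_eq_0_disj)

lemma ucont_scons: "ucont UNIV (scons b)"
  unfolding ucont_def
proof (intro allI exI ballI impI)
  fix n x y assume "agree n x y"
  then have "agree (Suc n) (scons b x) (scons b y)" by simp
  then show "agree n (scons b x) (scons b y)" by (rule agree_mono) simp
qed

lemma ucont_stail: "ucont A stail"
  unfolding ucont_def
proof (intro allI exI ballI impI)
  fix n x y assume "agree (Suc n) x y"
  then show "agree n (stail x) (stail y)" by (simp add: agree_Suc_iff)
qed

text \<open>
  Every nonempty clopen set is a Cantor set. If \<open>A\<close> is determined by \<open>n + 1\<close> coordinates, then it is
  the disjoint union of two sets determined by \<open>n\<close> coordinates, one behind each value of coordinate 0.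
  If one of them is empty, dropping the first coordinate identifies \<open>A\<close> with the other; if neither is
  empty, homeomorphisms of the two halves combine, because the Cantor space is itself the disjoint
  union of two copies of itself.
\<close>

lemma cantor_like_if_clopen:
  assumes "\<And>x y. agree n x y \<Longrightarrow> x \<in> A \<longleftrightarrow> y \<in> A" "A \<noteq> {}"
  shows "cantor_like A"
  using assms
proof (induction n arbitrary: A)
  case 0
  then have "A = UNIV" by (auto simp: agree_def)
  then show ?case unfolding cantor_like_def
    by (intro exI[of _ "\<lambda>x. x"]) (auto simp: ucont_def)
next
  case (Suc n)
  define B where "B b = {x. scons b x \<in> A}" for b
  have like: "cantor_like (B b)" if "B b \<noteq> {}" for b
    using that Suc.prems(1)[of "scons b _" "scons b _"] by (intro Suc.IH) (auto simp: B_def)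
  have A_iff: "x \<in> A \<longleftrightarrow> stail x \<in> B (x 0)" for x by (simp add: B_def)
  show ?case
  proof (cases "\<exists>b. B b = {}")
    case True
    then obtain b' where b': "B b' = {}" ..
    define b where "b = (\<not> b')"
    have b: "B (\<not> b) = {}" by (simp add: b_def b')
    have head: "x 0 = b" if "x \<in> A" for x using that b A_iff[of x] by (cases "x 0"; cases b) auto
    have "B b \<noteq> {}" using Suc.prems(2) head A_iff by blast
    then obtain f g where fg: "ucont UNIV f" "ucont (B b) g" "range f \<subseteq> B b"
      "\<And>x. g (f x) = x" "\<And>x. x \<in> B b \<Longrightarrow> f (g x) = x"
      by (rule cantor_likeE[OF like]) blast
    have tail: "stail x \<in> B b" if "x \<in> A" for x using A_iff[of x] head that by simp
    have "ucont UNIV (scons b \<circ> f)" by (rule ucont_comp[OF fg(1) ucont_scons]) simp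
    moreover have "ucont A (g \<circ> stail)"
      by (rule ucont_comp[OF ucont_stail fg(2)]) (use tail in blast)
    moreover have "range (scons b \<circ> f) \<subseteq> A" using fg(3) by (auto simp: B_def)
    moreover have "(scons b \<circ> f) ((g \<circ> stail) x) = x" if "x \<in> A" for x
      unfolding comp_apply fg(5)[OF tail[OF that]] head[OF that, symmetric] by (rule scons_simps(3))
    ultimately show ?thesis unfolding cantor_like_def
      by (intro exI[of _ "scons b \<circ> f"] exI[of _ "g \<circ> stail"]) (simp add: fg(4))
  next
    case False
    then have "\<forall>b. \<exists>f g. ucont UNIV f \<and> ucont (B b) g \<and> range f \<subseteq> B b \<and>
       (\<forall>x. g (f x) = x) \<and> (\<forall>x\<in>B b. f (g x) = x)"
      using like unfolding cantor_like_def by blast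
    then obtain f g where fg': "\<forall>b. ucont UNIV (f b) \<and> ucont (B b) (g b) \<and> range (f b) \<subseteq> B b \<and>
       (\<forall>x. g b (f b x) = x) \<and> (\<forall>x\<in>B b. f b (g b x) = x)"
      unfolding choice_iff by blast
    then have fg: "ucont UNIV (f b)" "ucont (B b) (g b)" "f b y \<in> B b" "g b (f b y) = y"
      "x \<in> B b \<Longrightarrow> f b (g b x) = x" for b x y
      by blast+
    let ?f = "\<lambda>x. scons (x 0) (f (x 0) (stail x))" and ?g = "\<lambda>x. scons (x 0) (g (x 0) (stail x))"
    have "ucont UNIV ?f"
      unfolding ucont_def
    proof
      fix k
      have "\<forall>b. \<exists>m. \<forall>x y. agree m x y \<longrightarrow> agree k (f b x) (f b y)"
        using fg(1) unfolding ucont_def by simp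
      then obtain m where "\<forall>b x y. agree (m b) x y \<longrightarrow> agree k (f b x) (f b y)"
        by (rule choice[THEN exE])
      then have m: "agree (m b) x y \<Longrightarrow> agree k (f b x) (f b y)" for b x y by blast
      have "agree k (?f x) (?f y)"
        if xy: "agree (Suc (max (m False) (m True))) x y" for x y
      proof -
        have head: "x 0 = y 0" using xy by (simp add: agree_Suc_iff)
        have "agree (max (m False) (m True)) (stail x) (stail y)" using xy by (simp add: agree_Suc_iff)
        then have "agree (m (x 0)) (stail x) (stail y)"
          by (rule agree_mono) (cases "x 0"; simp)
        then have "agree k (f (x 0) (stail x)) (f (x 0) (stail y))" by (rule m)
        then have "agree (Suc k) (?f x) (?f y)" by (simp add: head)
        then show ?thesis by (rule agree_mono) simp
      qed
      then show "\<exists>m. \<forall>x\<in>UNIV. \<forall>y\<in>UNIV. agree m x y \<longrightarrow> agree k (?f x) (?f y)" by blast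
    qed
    moreover have "ucont A ?g"
      unfolding ucont_def
    proof
      fix k
      have "\<forall>b. \<exists>m. \<forall>x\<in>B b. \<forall>y\<in>B b. agree m x y \<longrightarrow> agree k (g b x) (g b y)"
        using fg(2) unfolding ucont_def by simp
      then obtain m where "\<forall>b. \<forall>x\<in>B b. \<forall>y\<in>B b. agree (m b) x y \<longrightarrow> agree k (g b x) (g b y)"
        by (rule choice[THEN exE])
      then have m: "x \<in> B b \<Longrightarrow> y \<in> B b \<Longrightarrow> agree (m b) x y \<Longrightarrow> agree k (g b x) (g b y)"
        for b x y by blast
      have "agree k (?g x) (?g y)"
        if xy: "agree (Suc (max (m False) (m True))) x y" "x \<in> A" "y \<in> A" for x y
      proof -
        have head: "x 0 = y 0" using xy by (simp add: agree_Suc_iff)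
        have "agree (max (m False) (m True)) (stail x) (stail y)" using xy by (simp add: agree_Suc_iff)
        then have "agree (m (x 0)) (stail x) (stail y)"
          by (rule agree_mono) (cases "x 0"; simp)
        then have "agree k (g (x 0) (stail x)) (g (x 0) (stail y))"
          by (rule m[rotated 2]) (use that head A_iff in auto)
        then have "agree (Suc k) (?g x) (?g y)" by (simp add: head)
        then show ?thesis by (rule agree_mono) simp
      qed
      then show "\<exists>m. \<forall>x\<in>A. \<forall>y\<in>A. agree m x y \<longrightarrow> agree k (?g x) (?g y)" by blast
    qed
    ultimately show ?thesis unfolding cantor_like_def
      by (intro exI[of _ ?f] exI[of _ ?g]) (auto simp: A_iff fg)
  qed
qed

lemma cantor_like_homeomorphic:
  assumes "cantor_like A" "cantor_like B"
  obtains f g where "ucont A f" "ucont B g" "f ` A \<subseteq> B" "g ` B \<subseteq> A"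
    "\<And>x. x \<in> A \<Longrightarrow> g (f x) = x" "\<And>y. y \<in> B \<Longrightarrow> f (g y) = y"
proof -
  obtain p q where pq: "ucont UNIV p" "ucont A q" "range p \<subseteq> A" "\<And>x. q (p x) = x" "\<And>x. x \<in> A \<Longrightarrow> p (q x) = x"
    by (rule cantor_likeE[OF assms(1)]) blast
  obtain r s where rs: "ucont UNIV r" "ucont B s" "range r \<subseteq> B" "\<And>x. s (r x) = x" "\<And>x. x \<in> B \<Longrightarrow> r (s x) = x"
    by (rule cantor_likeE[OF assms(2)]) blast
  show ?thesis
    by (rule that[of "r \<circ> q" "p \<circ> s"])
      (use pq rs in \<open>auto intro!: ucont_comp[where B = UNIV]\<close>)
qed

text \<open>
  A locally constant function has finitely many fibres, so the largest of their moduli serves all.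
\<close>

lemma ucont_glue:
  assumes c: "locconst c" and f: "\<And>l. l \<in> range c \<Longrightarrow> ucont (c -` {l}) (f l)"
  shows "ucont UNIV (\<lambda>x. f (c x) x)"
  unfolding ucont_def
proof
  fix n
  obtain m0 where m0: "\<And>x y. agree m0 x y \<Longrightarrow> c x = c y" using c by (auto simp: locconst_def)
  have "\<forall>l\<in>range c. \<exists>m. \<forall>x\<in>c -` {l}. \<forall>y\<in>c -` {l}. agree m x y \<longrightarrow> agree n (f l x) (f l y)"
    using f unfolding ucont_def by blast
  then obtain m where "\<forall>l\<in>range c. \<forall>x\<in>c -` {l}. \<forall>y\<in>c -` {l}. agree (m l) x y \<longrightarrow> agree n (f l x) (f l y)"
    by (rule bchoice[THEN exE])
  then have m: "agree n (f l x) (f l y)" if "c x = l" "c y = l" "agree (m l) x y" for l x y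
    using that by blast
  let ?m = "Max (insert m0 (m ` range c))"
  have fin: "finite (insert m0 (m ` range c))" using finite_range_locconst[OF c] by simp
  have "agree n (f (c x) x) (f (c y) y)" if "agree ?m x y" for x y
  proof -
    have "c x = c y" using that fin by (intro m0 agree_mono[OF that]) simp
    moreover have "agree (m (c x)) x y" using fin by (intro agree_mono[OF that] Max_ge) auto
    ultimately have "agree n (f (c x) x) (f (c x) y)" by (intro m) simp_all
    then show ?thesis by (simp only: \<open>c x = c y\<close>)
  qed
  then show "\<exists>m. \<forall>x\<in>UNIV. \<forall>y\<in>UNIV. agree m x y \<longrightarrow> agree n (f (c x) x) (f (c y) y)" by blast
qed

text \<open>
  The source of all homeomorphisms constructed here. The fibres of \<open>c\<close> and \<open>c'\<close> over a common label
  are nonempty clopen sets, hence homeomorphic, and homeomorphisms between corresponding fibres glue.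
\<close>

lemma homeo_matching_labels:
  fixes c c' :: "(nat \<Rightarrow> bool) \<Rightarrow> 'a"
  assumes c: "locconst c" and c': "locconst c'" and range: "range c = range c'"
  obtains g where "g \<in> carrier cantor_homeo_group" "\<And>x. c' (g x) = c x"
proof -
  have like: "cantor_like (d -` {l})" if d: "locconst d" and l: "l \<in> range d"
    for d :: "(nat \<Rightarrow> bool) \<Rightarrow> 'a" and l
  proof -
    obtain m where m: "\<And>x y. agree m x y \<Longrightarrow> d x = d y" using d unfolding locconst_def by blast
    show ?thesis by (rule cantor_like_if_clopen[of m]) (use l m in auto)
  qed
  have "\<forall>l\<in>range c. \<exists>f g. ucont (c -` {l}) f \<and> ucont (c' -` {l}) g \<and> f ` (c -` {l}) \<subseteq> c' -` {l} \<and>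
      g ` (c' -` {l}) \<subseteq> c -` {l} \<and> (\<forall>x\<in>c -` {l}. g (f x) = x) \<and> (\<forall>x\<in>c' -` {l}. f (g x) = x)"
    using cantor_like_homeomorphic[OF like[OF c] like[OF c']] range by (metis (no_types, lifting))
  then obtain f g where fg: "\<And>l. l \<in> range c \<Longrightarrow> ucont (c -` {l}) (f l) \<and> ucont (c' -` {l}) (g l) \<and>
      f l ` (c -` {l}) \<subseteq> c' -` {l} \<and> g l ` (c' -` {l}) \<subseteq> c -` {l} \<and>
      (\<forall>x\<in>c -` {l}. g l (f l x) = x) \<and> (\<forall>x\<in>c' -` {l}. f l (g l x) = x)"
    by metis
  let ?f = "\<lambda>x. f (c x) x" and ?g = "\<lambda>y. g (c' y) y"
  have c'f: "c' (?f x) = c x" for x using fg[of "c x"] by auto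
  have cg: "c (?g y) = c' y" for y
  proof -
    have "c' y \<in> range c" by (simp add: range)
    then have "g (c' y) ` (c' -` {c' y}) \<subseteq> c -` {c' y}" using fg by blast
    then show ?thesis by blast
  qed
  have "?f \<in> carrier cantor_homeo_group"
  proof (rule homeoI(1))
    show "?g (?f x) = x" for x using fg[of "c x"] c'f[of x] by auto
    show "?f (?g y) = y" for y using fg[of "c' y"] cg[of y] range by auto
    show "ucont UNIV ?f" using fg by (intro ucont_glue c) auto
    show "ucont UNIV ?g" using fg range by (intro ucont_glue c') auto
  qed
  then show thesis using that c'f by blast
qed

section \<open>One-way splits\<close>

text \<open>
  Partition the space into the sets of points that agree up to \<open>N\<close> and cut every piece into its part
  inside \<open>U\<close> and its part outside. The conditions then say that orbits never leave \<open>U\<close>, that a piece inside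
  \<open>U\<close> has only one successor, and that a piece outside \<open>U\<close> has only one predecessor. In the
  graph of possible transitions between pieces, paths therefore branch only outside \<open>U\<close> and merge only
  inside, and the step at which a path enters \<open>U\<close> determines the whole path: its future because there is
  no branching inside, its past because there is no merging outside.
\<close>

definition one_way_split :: "nat \<Rightarrow> ((nat \<Rightarrow> bool) \<Rightarrow> (nat \<Rightarrow> bool)) \<Rightarrow> bool" where
  "one_way_split N h \<longleftrightarrow> (\<exists>U. locconst (\<lambda>x. x \<in> U) \<and> h ` U \<subseteq> U \<and>
     (\<forall>x\<in>U. \<forall>y\<in>U. agree N x y \<longrightarrow> agree N (h x) (h y)) \<and>
     (\<forall>x y. h x \<notin> U \<longrightarrow> h y \<notin> U \<longrightarrow> agree N (h x) (h y) \<longrightarrow> agree N x y))"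

lemma one_way_splitE:
  assumes "one_way_split N h"
  obtains U m where "\<And>x y. agree m x y \<Longrightarrow> x \<in> U \<longleftrightarrow> y \<in> U" "\<And>x. x \<in> U \<Longrightarrow> h x \<in> U"
    "\<And>x y. x \<in> U \<Longrightarrow> y \<in> U \<Longrightarrow> agree N x y \<Longrightarrow> agree N (h x) (h y)"
    "\<And>x y. h x \<notin> U \<Longrightarrow> h y \<notin> U \<Longrightarrow> agree N (h x) (h y) \<Longrightarrow> agree N x y"
proof -
  from assms[unfolded one_way_split_def locconst_def] obtain U m where
    "(\<forall>x y. agree m x y \<longrightarrow> (x \<in> U) = (y \<in> U)) \<and> h ` U \<subseteq> U \<and>
     (\<forall>x\<in>U. \<forall>y\<in>U. agree N x y \<longrightarrow> agree N (h x) (h y)) \<and>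
     (\<forall>x y. h x \<notin> U \<longrightarrow> h y \<notin> U \<longrightarrow> agree N (h x) (h y) \<longrightarrow> agree N x y)"
    by (elim exE conjE) blast
  then show thesis by (intro that[of m U]) blast+
qed

text \<open>
  The definition only mentions membership in the clopen set \<open>U\<close> and agreement up to \<open>N\<close> of the
  values of \<open>h\<close>, so finitely many coordinates of these values decide it.
\<close>

lemma one_way_split_stable:
  assumes "one_way_split N h"
  obtains m where "\<And>g. (\<And>x. agree m (h x) (g x)) \<Longrightarrow> one_way_split N g"
proof -
  obtain U m where U: "\<And>x y. agree m x y \<Longrightarrow> x \<in> U \<longleftrightarrow> y \<in> U" "\<And>x. x \<in> U \<Longrightarrow> h x \<in> U"
    "\<And>x y. x \<in> U \<Longrightarrow> y \<in> U \<Longrightarrow> agree N x y \<Longrightarrow> agree N (h x) (h y)"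
    "\<And>x y. h x \<notin> U \<Longrightarrow> h y \<notin> U \<Longrightarrow> agree N (h x) (h y) \<Longrightarrow> agree N x y"
    by (rule one_way_splitE[OF assms]) blast
  show thesis
  proof (rule that)
    fix g assume g: "\<And>x. agree (max m N) (h x) (g x)"
    have "h x \<in> U \<longleftrightarrow> g x \<in> U" for x by (rule U(1), rule agree_mono[OF g]) simp
    moreover have "agree N (h x) (h y) \<longleftrightarrow> agree N (g x) (g y)" for x y
      by (rule agree_cong) (rule agree_mono[OF g], simp)+
    moreover have "locconst (\<lambda>x. x \<in> U)" using U(1) unfolding locconst_def by blast
    ultimately show "one_way_split N g"
      unfolding one_way_split_def using U(2-4) by (intro exI[of _ U]) auto
  qed
qed

text \<open>
  Agreement of \<open>g\<close> with \<open>h\<close> up to \<open>N\<close> leaves the choice of \<open>g x\<close> inside a cylinder of length \<open>N\<close> free.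
  Choose \<open>M \<ge> N\<close> such that cylinders of length \<open>M\<close> are mapped by \<open>h\<close> into cylinders of length \<open>N\<close>. Let
  \<open>U\<close> consist of one smaller cylinder inside each cylinder of length \<open>N\<close>; agreement up to \<open>N\<close> inside \<open>U\<close>
  then implies agreement up to \<open>M\<close>, which gives a unique successor. Let \<open>W\<close>, which is disjoint from \<open>U\<close>,
  consist of one smaller cylinder inside the \<open>h\<close>-preimage of each cylinder of length \<open>N\<close>, and let \<open>g\<close> send
  exactly the points of \<open>W\<close> outside \<open>U\<close>. Then \<open>U\<close> is mapped into itself, and two points that are sent to
  the same cylinder but outside \<open>U\<close> lie in the same small cylinder, which gives a unique predecessor. The label functions \<open>c\<close> and \<open>c'\<close> encode these requirements on \<open>g\<close>.
\<close>

lemma one_way_split_dense: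
  assumes h: "h \<in> carrier cantor_homeo_group"
  obtains g where "g \<in> carrier cantor_homeo_group" "\<And>x. agree N (h x) (g x)" "one_way_split N g"
proof -
  have "ucont UNIV h" using h by (simp add: carrier_cantor_homeo_group)
  then obtain M0 where M0: "\<And>x y. agree M0 x y \<Longrightarrow> agree N (h x) (h y)" using ucontD by metis
  define M where "M = max M0 N"
  have M: "agree M x y \<Longrightarrow> agree N (h x) (h y)" for x y
    by (rule M0, erule agree_mono) (simp add: M_def)
  have NM: "N \<le> M" by (simp add: M_def)
  \<comment> \<open>The cylinder around this preimage becomes the only predecessor of the cylinder of the word \<open>b\<close> outside \<open>U\<close>.\<close>
  define \<beta> where "\<beta> b = inv_into UNIV h b" for b
  have \<beta>: "h (\<beta> b) = b" for b unfolding \<beta>_def by (rule homeo_inv(2)[OF h])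
  \<comment> \<open>Points of \<open>U\<close> and of \<open>W\<close> differ in coordinate \<open>M\<close>. Changing it in a point of \<open>U\<close> leads out of \<open>U\<close>
    within the same cylinder of length \<open>N\<close>, and in a point of \<open>W\<close> it leads out of \<open>W\<close> within the
    preimage of the same cylinder.\<close>
  define U where "U = {x. \<forall>k. N \<le> k \<longrightarrow> k \<le> M \<longrightarrow> \<not> x k}"
  define W where "W = {x. agree M x (\<beta> (word N (h x))) \<and> x M}"
  define c where "c x = (word N (h x), x \<in> W)" for x
  define c' where "c' y = (word N y, y \<notin> U)" for y
  have c: "locconst c"
    unfolding locconst_def
  proof (intro exI allI impI)
    fix x y assume xy: "agree (Suc M) x y"
    then have a: "agree M x y" by (rule agree_mono) simp
    then have "word N (h x) = word N (h y)" using M word_eq_iff by blast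
    moreover have "x M = y M" using xy by (simp add: agree_def)
    ultimately show "c x = c y"
      by (simp add: c_def W_def agree_cong[OF a agree_refl])
  qed
  have U: "x \<in> U \<longleftrightarrow> y \<in> U" if "agree (Suc M) x y" for x y
    using that unfolding U_def agree_def by (auto simp: less_Suc_eq_le)
  have c': "locconst c'"
    unfolding locconst_def
  proof (intro exI allI impI)
    fix x y assume xy: "agree (Suc M) x y"
    then have "agree N x y" by (rule agree_mono) (use NM in simp)
    then show "c' x = c' y" using U[OF xy] by (simp add: c'_def word_eq_iff)
  qed
  have ww: "word N (word N z) = word N z" for z by (auto simp: word_def)
  \<comment> \<open>Both label functions attain every pair of a word of length \<open>N\<close> and a truth value.\<close>
  have "(word N z, e) \<in> range c" for z e
  proof -
    let ?x = "(\<beta> (word N z))(M := e)"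
    have a: "agree M ?x (\<beta> (word N z))" by (simp add: agree_def)
    from M[OF a] have "word N (h ?x) = word N z" by (metis \<beta> word_eq_iff ww)
    then have "c ?x = (word N z, e)" using a by (simp add: c_def W_def)
    then show ?thesis by (intro range_eqI) (rule sym)
  qed
  moreover have "(word N z, e) \<in> range c'" for z e
  proof -
    let ?y = "\<lambda>k. if k < N then z k else e"
    have "?y \<in> U \<longleftrightarrow> \<not> e" using NM by (auto simp: U_def)
    moreover have "word N ?y = word N z" by (auto simp: word_def)
    ultimately have "c' ?y = (word N z, e)" by (simp add: c'_def)
    then show ?thesis by (intro range_eqI) (rule sym)
  qed
  ultimately have "range c = range c'" unfolding c_def c'_def by blast
  with c c' obtain g where g: "g \<in> carrier cantor_homeo_group" "\<And>x. c' (g x) = c x"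
    using homeo_matching_labels by blast
  have gU: "g x \<notin> U \<longleftrightarrow> x \<in> W" for x using g(2)[of x] by (simp add: c_def c'_def)
  have gh: "agree N (h x) (g x)" for x
    using g(2)[of x] by (simp add: c_def c'_def word_eq_iff agree_sym)
  have gg: "agree N (h x) (h y) \<longleftrightarrow> agree N (g x) (g y)" for x y
    using agree_cong[OF gh gh] .
  have "one_way_split N g"
    unfolding one_way_split_def
  proof (intro exI[of _ U] conjI ballI allI impI)
    show "locconst (\<lambda>x. x \<in> U)" using U unfolding locconst_def by blast
    show "g ` U \<subseteq> U" using gU NM by (auto simp: W_def U_def)
  next
    fix x y assume xy: "x \<in> U" "y \<in> U" "agree N x y"
    \<comment> \<open>Between \<open>N\<close> and \<open>M\<close> all coordinates of points of \<open>U\<close> are \<open>False\<close>.\<close>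
    then have "agree M x y" unfolding U_def agree_def by (simp, metis less_imp_le not_less)
    then show "agree N (g x) (g y)" using M gg by blast
  next
    fix x y assume xy: "g x \<notin> U" "g y \<notin> U" "agree N (g x) (g y)"
    then have "x \<in> W" "y \<in> W" "word N (h x) = word N (h y)" using gU gg word_eq_iff by blast+
    then have "agree M x (\<beta> (word N (h y)))" "agree M y (\<beta> (word N (h y)))" by (simp_all add: W_def)
    then have "agree M x y" using agree_trans agree_sym by blast
    then show "agree N x y" using NM agree_mono by blast
  qed
  then show thesis using that g(1) gh by blast
qed

section \<open>From one-way splits to shadowing\<close>

lemma int_iterate_step:
  assumes h: "h \<in> carrier cantor_homeo_group"
  shows "int_iterate UNIV h (n + 1) y = h (int_iterate UNIV h n y)"
proof (cases "n \<ge> 0")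
  case True
  then show ?thesis by (simp add: int_iterate_def nat_add_distrib)
next
  case False
  define k where "k = nat (- (n + 1))"
  have k: "nat (- n) = Suc k" using False by (simp add: k_def)
  have "h (int_iterate UNIV h n y) = h (inv_into UNIV h ((inv_into UNIV h ^^ k) y))"
    using False by (simp add: int_iterate_def k)
  also have "\<dots> = (inv_into UNIV h ^^ k) y" by (rule homeo_inv(2)[OF h])
  also have "\<dots> = int_iterate UNIV h (n + 1) y"
    using False by (cases "n = - 1") (simp_all add: int_iterate_def k_def)
  finally show ?thesis by simp
qed

lemma orbit_eq_int_iterate:
  assumes h: "h \<in> carrier cantor_homeo_group" and z: "\<forall>i. z (i + 1) = h (z i)"
  shows "z n = int_iterate UNIV h n (z 0)"
proof (induction n rule: int_induct[of _ 0])
  case base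
  then show ?case by (simp add: int_iterate_def)
next
  case (step1 i)
  then show ?case by (simp add: z[rule_format] int_iterate_step[OF h])
next
  case (step2 i)
  have "h (z (i - 1)) = h (int_iterate UNIV h (i - 1) (z 0))"
    using step2 z[rule_format, of "i - 1"] int_iterate_step[OF h, of "i - 1"] by simp
  then show ?case using homeo_inv(1)[OF h] by metis
qed

lemma orbit_through:
  assumes h: "h \<in> carrier cantor_homeo_group"
  obtains z :: "int \<Rightarrow> nat \<Rightarrow> bool" where "\<forall>i. z (i + 1) = h (z i)" "z j = p"
proof (rule that[of "\<lambda>i. int_iterate UNIV h (i - j) p"])
  show "\<forall>i. int_iterate UNIV h (i + 1 - j) p = h (int_iterate UNIV h (i - j) p)"
    using int_iterate_step[OF h, of "_ - j"] by (simp add: algebra_simps)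
qed (simp add: int_iterate_def)

lemma ucont_int_iterate:
  "h \<in> carrier cantor_homeo_group \<Longrightarrow> ucont UNIV (int_iterate UNIV h i)"
  by (simp add: int_iterate_def carrier_cantor_homeo_group ucont_funpow)

text \<open>
  Shadowing at fixed precisions. The orbit is a bi-infinite sequence and not given by its starting
  point, so that a tracing orbit can be anchored at any time.
\<close>

definition traceable where
  "traceable n m h \<longleftrightarrow> (\<forall>x :: int \<Rightarrow> nat \<Rightarrow> bool. (\<forall>i. agree m (h (x i)) (x (i + 1))) \<longrightarrow>
     (\<exists>z. (\<forall>i. z (i + 1) = h (z i)) \<and> (\<forall>i. agree n (x i) (z i))))"

lemma shadowing_iff_traceable:
  assumes h: "h \<in> carrier cantor_homeo_group"
  shows "Cantor.shadowing_property h \<longleftrightarrow> (\<forall>n. \<exists>m. traceable n m h)"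
proof
  assume sh: "Cantor.shadowing_property h"
  show "\<forall>n. \<exists>m. traceable n m h"
  proof
    fix n
    obtain \<delta> where \<delta>: "\<delta> > 0" and y: "\<And>x. Cantor.pseudotrajectory h \<delta> x \<Longrightarrow>
        \<exists>y. \<forall>i. cantor_dist (x i) (int_iterate UNIV h i y) < 1 / real (Suc n)"
      using sh[unfolded Cantor.shadowing_property_def, rule_format, of "1 / real (Suc n)"] by auto
    obtain m where m: "1 / real (Suc m) < \<delta>" using \<delta> by (rule nat_approx_posE)
    have "traceable n (Suc m) h"
      unfolding traceable_def
    proof (intro allI impI)
      fix x :: "int \<Rightarrow> nat \<Rightarrow> bool"
      assume "\<forall>i. agree (Suc m) (h (x i)) (x (i + 1))"
      then have "\<forall>i. cantor_dist (h (x i)) (x (i + 1)) < 1 / real (Suc m)"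
        unfolding cantor_dist_less_iff_agree .
      then have "Cantor.pseudotrajectory h \<delta> x"
        using m unfolding Cantor.pseudotrajectory_def by (meson less_imp_le less_trans subset_UNIV)
      then obtain y where "\<And>i. agree (Suc n) (x i) (int_iterate UNIV h i y)"
        using y unfolding cantor_dist_less_iff_agree by blast
      then have "\<And>i. agree n (x i) (int_iterate UNIV h i y)" using agree_mono le_SucI by blast
      then show "\<exists>z. (\<forall>i. z (i + 1) = h (z i)) \<and> (\<forall>i. agree n (x i) (z i))"
        using int_iterate_step[OF h] by (intro exI[of _ "\<lambda>i. int_iterate UNIV h i y"]) blast
    qed
    then show "\<exists>m. traceable n m h" ..
  qed
next
  assume tr: "\<forall>n. \<exists>m. traceable n m h"
  show "Cantor.shadowing_property h"
    unfolding Cantor.shadowing_property_def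
  proof (intro allI impI)
    fix \<epsilon> :: real assume "\<epsilon> > 0"
    then obtain n where n: "1 / real (Suc n) < \<epsilon>" by (rule nat_approx_posE)
    obtain m where m: "traceable (Suc n) m h" using tr by blast
    have "\<exists>y\<in>UNIV. \<forall>i. cantor_dist (x i) (int_iterate UNIV h i y) < \<epsilon>"
      if x: "Cantor.pseudotrajectory h (1 / real (Suc (Suc m))) x" for x
    proof -
      have "cantor_dist (h (x i)) (x (i + 1)) \<le> 1 / real (Suc (Suc m))" for i
        using x by (simp add: Cantor.pseudotrajectory_def)
      \<comment> \<open>Pseudotrajectories are defined by a weak inequality, agreement by a strict one.\<close>
      moreover have "1 / real (Suc (Suc m)) < 1 / real (Suc m)" by (simp add: divide_simps)
      ultimately have "agree (Suc m) (h (x i)) (x (i + 1))" for i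
        unfolding cantor_dist_less_iff_agree[symmetric] using le_less_trans by blast
      then have "agree m (h (x i)) (x (i + 1))" for i using agree_mono le_SucI by blast
      then obtain z where z: "\<forall>i. z (i + 1) = h (z i)" "\<forall>i. agree (Suc n) (x i) (z i)"
        using m unfolding traceable_def by blast
      have "cantor_dist (x i) (int_iterate UNIV h i (z 0)) < \<epsilon>" for i
        using z(2)[rule_format, of i] n
        unfolding orbit_eq_int_iterate[OF h z(1), of i] cantor_dist_less_iff_agree[symmetric]
        by (rule less_trans)
      then show ?thesis by blast
    qed
    then show "\<exists>\<delta>>0. \<forall>x. Cantor.pseudotrajectory h \<delta> x \<longrightarrow>
        (\<exists>y\<in>UNIV. \<forall>i. cantor_dist (x i) (int_iterate UNIV h i y) < \<epsilon>)"
      by (intro exI[of _ "1 / real (Suc (Suc m))"]) simp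
  qed
qed

text \<open>
  A conjugating homeomorphism and its inverse are uniformly continuous, so they carry
  pseudotrajectories to pseudotrajectories and traces to traces.
\<close>

lemma shadowing_conjugate:
  assumes f: "f \<in> carrier cantor_homeo_group" and k: "k \<in> carrier cantor_homeo_group"
    and sh: "Cantor.shadowing_property f"
  shows "Cantor.shadowing_property (k \<circ> f \<circ> inv_into UNIV k)"
proof -
  let ?k' = "inv_into UNIV k" and ?h = "k \<circ> f \<circ> inv_into UNIV k"
  have h: "?h \<in> carrier cantor_homeo_group"
    using f k homeo_comp_closed homeo_inv_closed by blast
  have uk: "ucont UNIV k" "ucont UNIV ?k'" using k by (auto simp: carrier_cantor_homeo_group)
  have "\<exists>m. traceable n m ?h" for n
  proof -
    obtain n' where n': "\<And>x y. agree n' x y \<Longrightarrow> agree n (k x) (k y)" using ucontD[OF uk(1)] by metis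
    obtain m' where m': "traceable n' m' f" using sh shadowing_iff_traceable[OF f] by blast
    obtain m where m: "\<And>x y. agree m x y \<Longrightarrow> agree m' (?k' x) (?k' y)" using ucontD[OF uk(2)] by metis
    have "traceable n m ?h"
      unfolding traceable_def
    proof (intro allI impI)
      fix x :: "int \<Rightarrow> nat \<Rightarrow> bool"
      assume x: "\<forall>i. agree m (?h (x i)) (x (i + 1))"
      have "agree m' (f (?k' (x i))) (?k' (x (i + 1)))" for i
        using m[OF x[rule_format, of i]] homeo_inv(1)[OF k] by simp
      then obtain z where z: "\<And>i. z (i + 1) = f (z i)" "\<And>i. agree n' (?k' (x i)) (z i)"
        using m'[unfolded traceable_def, rule_format, of "\<lambda>i. ?k' (x i)"] by blast
      show "\<exists>z. (\<forall>i. z (i + 1) = ?h (z i)) \<and> (\<forall>i. agree n (x i) (z i))"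
      proof (intro exI[of _ "\<lambda>i. k (z i)"] conjI allI)
        show "k (z (i + 1)) = ?h (k (z i))" for i by (simp add: z(1) homeo_inv(1)[OF k])
        show "agree n (x i) (k (z i))" for i using n'[OF z(2)[of i]] homeo_inv(2)[OF k] by simp
      qed
    qed
    then show ?thesis ..
  qed
  then show ?thesis using shadowing_iff_traceable[OF h] by blast
qed

text \<open>
  The starting points whose orbits trace \<open>x\<close> on the window from \<open>-K\<close> to \<open>K\<close> form a decreasing sequence
  of nonempty closed sets, so some point lies in all of them.
\<close>

lemma trace_compactness:
  assumes h: "h \<in> carrier cantor_homeo_group"
    and fin: "\<And>K :: nat. \<exists>z. (\<forall>i. z (i + 1) = h (z i)) \<and> (\<forall>i. \<bar>i\<bar> \<le> int K \<longrightarrow> agree n (x i) (z i))"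
  shows "\<exists>z. (\<forall>i. z (i + 1) = h (z i)) \<and> (\<forall>i. agree n (x i) (z i))"
proof -
  let ?D = "\<lambda>i. {y. agree n (x i) (int_iterate UNIV h i y)}"
  let ?C = "\<lambda>K :: nat. \<Inter>i\<in>{i. \<bar>i\<bar> \<le> int K}. ?D i"
  have "closedin cantor_topology (?D i)" for i
  proof -
    obtain m where m: "\<And>a b. agree m a b \<Longrightarrow> agree n (int_iterate UNIV h i a) (int_iterate UNIV h i b)"
      using ucontD[OF ucont_int_iterate[OF h]] by metis
    have "\<exists>r>0. Cantor.mball y r \<subseteq> UNIV - ?D i" if y: "y \<in> UNIV - ?D i" for y
    proof -
      have "Cantor.mball y (1 / real (Suc m)) \<subseteq> UNIV - ?D i"
      proof
        fix y' assume "y' \<in> Cantor.mball y (1 / real (Suc m))"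
        then have "cantor_dist y y' < 1 / real (Suc m)" by (simp only: Cantor.in_mball)
        then have "agree m y y'" unfolding cantor_dist_less_iff_agree by (rule agree_mono) simp
        then show "y' \<in> UNIV - ?D i" using y m agree_sym agree_trans by blast
      qed
      then show ?thesis by (intro exI[of _ "1 / real (Suc m)"]) simp
    qed
    then have "openin Cantor.mtopology (UNIV - ?D i)"
      unfolding Cantor.openin_mtopology by blast
    then show ?thesis by (simp add: closedin_def cantor_mtopology) (simp add: cantor_topology_def)
  qed
  then have "closedin cantor_topology (?C K)" for K by (intro closedin_INT) (auto intro: exI[of _ 0])
  moreover have "?C K \<noteq> {}" for K
  proof -
    obtain z where z: "\<forall>i. z (i + 1) = h (z i)" "\<forall>i. \<bar>i\<bar> \<le> int K \<longrightarrow> agree n (x i) (z i)"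
      using fin by blast
    have "z 0 \<in> ?C K" using z(2) by (simp add: orbit_eq_int_iterate[OF h z(1), symmetric])
    then show ?thesis by blast
  qed
  moreover have "decseq ?C" unfolding decseq_def by (intro allI impI INT_anti_mono) auto
  ultimately have "(\<Inter>K. ?C K) \<noteq> {}" by (intro compact_space_imp_nest[OF compact_cantor_topology])
  then obtain y where y: "\<And>K. y \<in> ?C K" by blast
  have "agree n (x i) (int_iterate UNIV h i y)" for i using y[of "nat \<bar>i\<bar>"] by auto
  then show ?thesis
    using int_iterate_step[OF h] by (intro exI[of _ "\<lambda>i. int_iterate UNIV h i y"]) blast
qed

text \<open>
  If the errors of a pseudotrajectory affect neither membership in \<open>U\<close> nor agreement up to \<open>N\<close>, then
  it obeys the same rules as an orbit: once in \<open>U\<close> it stays there. By compactness it is enough to trace it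
  on a finite window. If it is inside \<open>U\<close> throughout the window, the orbit through its first point traces
  it; if it is outside throughout, the orbit through its last point does; otherwise it crosses into \<open>U\<close>
  at some step, and the orbit through the last point outside traces it in both directions.
\<close>

lemma traceable_if_one_way_split:
  assumes h: "h \<in> carrier cantor_homeo_group" and split: "one_way_split N h"
  obtains m where "traceable N m h"
proof -
  obtain U m where U: "\<And>x y. agree m x y \<Longrightarrow> x \<in> U \<longleftrightarrow> y \<in> U" "\<And>x. x \<in> U \<Longrightarrow> h x \<in> U"
    "\<And>x y. x \<in> U \<Longrightarrow> y \<in> U \<Longrightarrow> agree N x y \<Longrightarrow> agree N (h x) (h y)"
    "\<And>x y. h x \<notin> U \<Longrightarrow> h y \<notin> U \<Longrightarrow> agree N (h x) (h y) \<Longrightarrow> agree N x y"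
    by (rule one_way_splitE[OF split]) blast
  have "traceable N (max m N) h"
    unfolding traceable_def
  proof (intro allI impI trace_compactness[OF h])
    fix x :: "int \<Rightarrow> nat \<Rightarrow> bool" and K :: nat
    assume x: "\<forall>i. agree (max m N) (h (x i)) (x (i + 1))"
    have xU: "h (x i) \<in> U \<longleftrightarrow> x (i + 1) \<in> U" for i
      using U(1) agree_mono[OF x[rule_format, of i], of m] by simp
    have xN: "agree N (h (x i)) (x (i + 1))" for i
      using agree_mono[OF x[rule_format, of i], of N] by simp
    have forward: "agree N (x i) (z i)"
      if z: "\<forall>i. z (i + 1) = h (z i)" and j: "x j \<in> U" "z j \<in> U" "agree N (x j) (z j)" and "j \<le> i"
      for z i j
    proof -
      have "x i \<in> U \<and> z i \<in> U \<and> agree N (x i) (z i)"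
        using \<open>j \<le> i\<close>
      proof (induction i rule: int_ge_induct)
        case base
        then show ?case using j by blast
      next
        case (step i)
        then have "agree N (h (x i)) (h (z i))" using U(3) by blast
        then have "agree N (x (i + 1)) (z (i + 1))"
          unfolding z[rule_format] by (rule agree_trans[OF agree_sym[OF xN]])
        moreover have "x (i + 1) \<in> U" using step U(2) xU by blast
        moreover have "z (i + 1) \<in> U" using step U(2) z by simp
        ultimately show ?case by blast
      qed
      then show ?thesis by blast
    qed
    have backward: "agree N (x i) (z i)"
      if z: "\<forall>i. z (i + 1) = h (z i)" and j: "x j \<notin> U" "z j \<notin> U" "agree N (x j) (z j)" and "i \<le> j"
      for z i j
    proof -
      have "x i \<notin> U \<and> z i \<notin> U \<and> agree N (x i) (z i)"
        using \<open>i \<le> j\<close>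
      proof (induction i rule: int_le_induct)
        case base
        then show ?case using j by blast
      next
        case (step i)
        have zi: "h (z (i - 1)) = z i" using z[rule_format, of "i - 1"] by simp
        have hx: "h (x (i - 1)) \<notin> U" using xU[of "i - 1"] step by simp
        have "agree N (h (x (i - 1))) (h (z (i - 1)))"
          using agree_trans[OF xN[of "i - 1"], of "z i"] step zi by simp
        then have "agree N (x (i - 1)) (z (i - 1))" using U(4) hx zi step by simp
        then show ?case using U(2)[of "x (i - 1)"] U(2)[of "z (i - 1)"] hx zi step by auto
      qed
      then show ?thesis by blast
    qed
    show "\<exists>z. (\<forall>i. z (i + 1) = h (z i)) \<and> (\<forall>i. \<bar>i\<bar> \<le> int K \<longrightarrow> agree N (x i) (z i))"
    proof (cases "x (- int K) \<in> U")
      case True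
      obtain z where z: "\<forall>i. z (i + 1) = h (z i)" "z (- int K) = x (- int K)"
        by (rule orbit_through[OF h])
      have "agree N (x i) (z i)" if "\<bar>i\<bar> \<le> int K" for i
        by (rule forward[OF z(1), of "- int K"]) (use that True z(2) in simp_all)
      then show ?thesis using z(1) by blast
    next
      case left: False
      show ?thesis
      proof (cases "x (int K) \<in> U")
        case False
        obtain z where z: "\<forall>i. z (i + 1) = h (z i)" "z (int K) = x (int K)"
          by (rule orbit_through[OF h])
        have "agree N (x i) (z i)" if "\<bar>i\<bar> \<le> int K" for i
          by (rule backward[OF z(1), of "int K"]) (use that False z(2) in simp_all)
        then show ?thesis using z(1) by blast
      next
        case True
        have "\<exists>j. x j \<notin> U \<and> x (j + 1) \<in> U"
        proof (rule ccontr)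
          assume no: "\<nexists>j. x j \<notin> U \<and> x (j + 1) \<in> U"
          have "x i \<notin> U" if "- int K \<le> i" for i
            using that by (induction i rule: int_ge_induct) (use left no in blast)+
          then show False using True by simp
        qed
        then obtain j where j: "x j \<notin> U" "x (j + 1) \<in> U" by blast
        obtain z where z: "\<forall>i. z (i + 1) = h (z i)" "z j = x j"
          by (rule orbit_through[OF h])
        have "agree N (x i) (z i)" for i
        proof (cases "i \<le> j")
          case True
          show ?thesis by (rule backward[OF z(1), of j]) (use True j z(2) in simp_all)
        next
          case False
          have step: "z (j + 1) = h (x j)" using z by simp
          show ?thesis
          proof (rule forward[OF z(1), of "j + 1"])
            show "z (j + 1) \<in> U" using j(2) xU[of j] step by simp
            show "agree N (x (j + 1)) (z (j + 1))" using agree_sym[OF xN[of j]] step by simp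
          qed (use False j in simp_all)
        qed
        then show ?thesis using z(1) by blast
      qed
    qed
  qed
  then show thesis by (rule that)
qed

lemma shadowing_if_one_way_splits:
  assumes h: "h \<in> carrier cantor_homeo_group" and split: "\<And>n. \<exists>N\<ge>n. one_way_split N h"
  shows "Cantor.shadowing_property h"
  unfolding shadowing_iff_traceable[OF h]
proof
  fix n
  obtain N m where "n \<le> N" "traceable N m h"
    using split traceable_if_one_way_split[OF h] by metis
  then have "traceable n m h" unfolding traceable_def using agree_mono by metis
  then show "\<exists>m. traceable n m h" ..
qed

section \<open>The homeomorphism group is a Baire space\<close>

text \<open>
  The uniform distance is not complete on the homeomorphism group, since a uniform limit of
  homeomorphisms need not be injective. Controlling the inverses as well repairs this without changing
  the topology.
\<close>

definition homeo_dist :: "((nat \<Rightarrow> bool) \<Rightarrow> (nat \<Rightarrow> bool)) \<Rightarrow> ((nat \<Rightarrow> bool) \<Rightarrow> (nat \<Rightarrow> bool)) \<Rightarrow> real" where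
  "homeo_dist f g = max (cantor_sup_dist f g) (cantor_sup_dist (inv_into UNIV f) (inv_into UNIV g))"

interpretation Polish: Metric_space "carrier cantor_homeo_group" homeo_dist
proof
  fix f g h assume fgh: "f \<in> carrier cantor_homeo_group" "g \<in> carrier cantor_homeo_group"
    "h \<in> carrier cantor_homeo_group"
  note inv = fgh[THEN homeo_inv_closed]
  show "homeo_dist f g = 0 \<longleftrightarrow> f = g"
    if "f \<in> carrier cantor_homeo_group" "g \<in> carrier cantor_homeo_group" for f g
  proof
    assume "homeo_dist f g = 0"
    then have "cantor_sup_dist f g \<le> 0" by (simp add: homeo_dist_def max_def split: if_splits)
    then have "cantor_sup_dist f g = 0" using Homeo.nonneg[of f g] by linarith
    then show "f = g" using Homeo.zero[OF that] by blast
  qed (use that in \<open>simp add: homeo_dist_def homeo_inv_closed\<close>)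
  show "homeo_dist f h \<le> homeo_dist f g + homeo_dist g h"
    using Homeo.triangle[OF fgh] Homeo.triangle[OF inv] by (auto simp: homeo_dist_def)
qed (auto simp: homeo_dist_def Homeo.commute intro: max.coboundedI1)

lemma homeo_dist_less_iff_agree:
  "homeo_dist f g < 1 / real (Suc n) \<longleftrightarrow> (\<forall>x. agree (Suc n) (f x) (g x)) \<and>
     (\<forall>x. agree (Suc n) (inv_into UNIV f x) (inv_into UNIV g x))"
  unfolding homeo_dist_def max_less_iff_conj cantor_sup_dist_less_iff_agree ..

text \<open>
  Inversion is continuous at \<open>f\<close>: if \<open>g\<close> is near \<open>f\<close> and \<open>x\<close> is the point with \<open>g x = y\<close>, then \<open>f x\<close> is near
  \<open>y\<close>, and the modulus of the inverse of \<open>f\<close> brings \<open>x\<close> near to the \<open>f\<close>-preimage of \<open>y\<close>.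
\<close>

lemma inverse_continuous:
  assumes f: "f \<in> carrier cantor_homeo_group"
  obtains m where "\<And>g x. g \<in> carrier cantor_homeo_group \<Longrightarrow> (\<And>x. agree m (f x) (g x)) \<Longrightarrow>
    agree n (inv_into UNIV f x) (inv_into UNIV g x)"
proof -
  have "ucont UNIV (inv_into UNIV f)" using f by (simp add: carrier_cantor_homeo_group)
  then obtain m where m: "\<And>x y. agree m x y \<Longrightarrow> agree n (inv_into UNIV f x) (inv_into UNIV f y)"
    using ucontD by metis
  show thesis
  proof (rule that)
    fix g y assume g: "g \<in> carrier cantor_homeo_group" "\<And>x. agree m (f x) (g x)"
    let ?x = "inv_into UNIV g y"
    have "agree m (f ?x) y" using g(2)[of ?x] homeo_inv(2)[OF g(1)] by simp
    from m[OF this] have "agree n ?x (inv_into UNIV f y)" using homeo_inv(1)[OF f] by simp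
    then show "agree n (inv_into UNIV f y) ?x" by (rule agree_sym)
  qed
qed

lemma Polish_mtopology: "Polish.mtopology = Homeo.mtopology"
proof (rule topology_eq[THEN iffD2], rule allI)
  fix S
  have "(\<exists>r>0. Polish.mball f r \<subseteq> S) \<longleftrightarrow> (\<exists>r>0. Homeo.mball f r \<subseteq> S)"
    if f: "f \<in> carrier cantor_homeo_group" for f
  proof
    assume "\<exists>r>0. Homeo.mball f r \<subseteq> S"
    then obtain r where "r > 0" "Homeo.mball f r \<subseteq> S" by blast
    moreover have "Polish.mball f r \<subseteq> Homeo.mball f r" by (auto simp: homeo_dist_def)
    ultimately show "\<exists>r>0. Polish.mball f r \<subseteq> S" by blast
  next
    assume "\<exists>r>0. Polish.mball f r \<subseteq> S"
    then obtain r where r: "r > 0" "Polish.mball f r \<subseteq> S" by blast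
    obtain n where n: "1 / real (Suc n) < r" using r(1) by (rule nat_approx_posE)
    obtain m where m: "\<And>g x. g \<in> carrier cantor_homeo_group \<Longrightarrow> (\<And>x. agree m (f x) (g x)) \<Longrightarrow>
        agree (Suc n) (inv_into UNIV f x) (inv_into UNIV g x)"
      using inverse_continuous[OF f] by metis
    have "Homeo.mball f (1 / real (Suc (max m n))) \<subseteq> Polish.mball f r"
    proof
      fix g assume "g \<in> Homeo.mball f (1 / real (Suc (max m n)))"
      then have g: "g \<in> carrier cantor_homeo_group"
        and "cantor_sup_dist f g < 1 / real (Suc (max m n))" unfolding Homeo.in_mball by blast+
      then have fg: "\<And>x. agree (Suc (max m n)) (f x) (g x)"
        unfolding cantor_sup_dist_less_iff_agree by blast
      have "agree m (f x) (g x)" "agree (Suc n) (f x) (g x)" for x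
        by (rule agree_mono[OF fg], simp)+
      then have "homeo_dist f g < 1 / real (Suc n)"
        unfolding homeo_dist_less_iff_agree using m[OF g] by blast
      then show "g \<in> Polish.mball f r" using n f g by simp
    qed
    then show "\<exists>r>0. Homeo.mball f r \<subseteq> S"
      using r(2) by (intro exI[of _ "1 / real (Suc (max m n))"]) auto
  qed
  then show "openin Polish.mtopology S \<longleftrightarrow> openin Homeo.mtopology S"
    unfolding Polish.openin_mtopology Homeo.openin_mtopology by blast
qed

abbreviation uniformly_converges where
  "uniformly_converges \<sigma> f \<equiv> \<forall>n. \<exists>K::nat. \<forall>k\<ge>K. \<forall>x. agree n (\<sigma> k x) (f x)"

lemma uniform_limit_exists:
  fixes \<sigma> :: "nat \<Rightarrow> 'a \<Rightarrow> (nat \<Rightarrow> bool)"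
  assumes "\<And>n. \<exists>K. \<forall>k\<ge>K. \<forall>x. agree n (\<sigma> K x) (\<sigma> k x)"
  obtains f where "uniformly_converges \<sigma> f"
proof -
  obtain K where K: "\<And>n k x. K n \<le> k \<Longrightarrow> agree n (\<sigma> (K n) x) (\<sigma> k x)" using assms by metis
  define f where "f x = (\<lambda>j. \<sigma> (K (Suc j)) x j)" for x
  have "agree n (\<sigma> k x) (f x)" if k: "\<forall>j\<le>n. K j \<le> k" for n k x
    unfolding agree_def
  proof (intro allI impI)
    fix j assume "j < n"
    then have "agree (Suc j) (\<sigma> (K (Suc j)) x) (\<sigma> k x)" using k by (intro K) simp
    then show "\<sigma> k x j = f x j" by (simp add: agree_def f_def)
  qed
  moreover have "\<exists>M. \<forall>k\<ge>M. \<forall>j\<le>n. K j \<le> k" for n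
    by (rule exI[of _ "Max (K ` {..n})"]) simp
  ultimately have "uniformly_converges \<sigma> f" by meson
  then show thesis by (rule that)
qed

lemma ucont_uniform_limit:
  assumes "\<And>k. ucont UNIV (\<sigma> k)" and lim: "uniformly_converges \<sigma> f"
  shows "ucont UNIV f"
  unfolding ucont_def
proof
  fix n
  obtain K where "\<forall>x. agree n (\<sigma> K x) (f x)" using lim by blast
  then have K: "agree n (\<sigma> K x) (f x)" for x ..
  obtain m where "\<And>x y. agree m x y \<Longrightarrow> agree n (\<sigma> K x) (\<sigma> K y)" using ucontD[OF assms(1)] by metis
  then have "agree n (f x) (f y)" if "agree m x y" for x y
    using that agree_cong[OF K K] by blast
  then show "\<exists>m. \<forall>x\<in>UNIV. \<forall>y\<in>UNIV. agree m x y \<longrightarrow> agree n (f x) (f y)" by blast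
qed

text \<open>
  Inverse relations survive uniform limits; this is why limits of Cauchy sequences in the complete
  metric are again invertible.
\<close>

lemma uniform_limit_comp:
  assumes \<sigma>: "\<And>k. ucont UNIV (\<sigma> k)" and id: "\<And>k x. \<sigma> k (\<tau> k x) = x"
    and f: "uniformly_converges \<sigma> f" and g: "uniformly_converges \<tau> g"
  shows "f (g x) = x"
proof (rule eq_if_agree)
  fix n
  obtain m where m: "\<And>x y. agree m x y \<Longrightarrow> agree n (f x) (f y)"
    using ucontD[OF ucont_uniform_limit[OF \<sigma> f]] by metis
  obtain K :: nat where K: "\<forall>k\<ge>K. \<forall>x. agree n (\<sigma> k x) (f x)" using f by blast
  obtain K' :: nat where K': "\<forall>k\<ge>K'. \<forall>x. agree m (\<tau> k x) (g x)" using g by blast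
  let ?k = "max K K'"
  have "agree n (f (g x)) (f (\<tau> ?k x))" using K' by (intro m agree_sym[of _ "\<tau> ?k x"]) simp
  also have "agree n (f (\<tau> ?k x)) (\<sigma> ?k (\<tau> ?k x))" using K by (intro agree_sym[of _ "\<sigma> ?k _"]) simp
  finally show "agree n (f (g x)) x" by (simp add: id)
qed

lemma Polish_mcomplete: "Polish.mcomplete"
  unfolding Polish.mcomplete_def
proof (intro allI impI)
  fix \<sigma> assume \<sigma>: "Polish.MCauchy \<sigma>"
  let ?\<tau> = "\<lambda>k. inv_into UNIV (\<sigma> k)"
  have car: "\<sigma> k \<in> carrier cantor_homeo_group" for k using \<sigma> by (auto simp: Polish.MCauchy_def)
  have cauchy: "\<exists>K. \<forall>k\<ge>K. homeo_dist (\<sigma> K) (\<sigma> k) < 1 / real (Suc n)" for n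
    using \<sigma> unfolding Polish.MCauchy_def by (metis of_nat_0_less_iff order_refl zero_less_Suc zero_less_divide_1_iff)
  have "\<exists>K. \<forall>k\<ge>K. \<forall>x. agree n (\<sigma> K x) (\<sigma> k x)" for n
    using cauchy[of n] agree_mono[of "Suc n" _ _ n] unfolding homeo_dist_less_iff_agree by (meson le_SucI order_refl)
  then obtain f where f: "uniformly_converges \<sigma> f" by (rule uniform_limit_exists)
  have "\<exists>K. \<forall>k\<ge>K. \<forall>x. agree n (?\<tau> K x) (?\<tau> k x)" for n
    using cauchy[of n] agree_mono[of "Suc n" _ _ n] unfolding homeo_dist_less_iff_agree by (meson le_SucI order_refl)
  then obtain g where g: "uniformly_converges ?\<tau> g" by (rule uniform_limit_exists)
  have uc: "ucont UNIV (\<sigma> k)" "ucont UNIV (?\<tau> k)" for k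
    using car[of k] by (simp_all add: carrier_cantor_homeo_group)
  have fg: "g (f x) = x" "f (g x) = x" for x
    using uniform_limit_comp[OF uc(2) homeo_inv(1)[OF car] g f]
      uniform_limit_comp[OF uc(1) homeo_inv(2)[OF car] f g] by blast+
  have "ucont UNIV f" "ucont UNIV g"
    using ucont_uniform_limit[OF uc(1) f] ucont_uniform_limit[OF uc(2) g] by blast+
  from homeoI[OF fg this] have f_car: "f \<in> carrier cantor_homeo_group" and inv: "inv_into UNIV f = g" by blast+
  have "\<exists>K. \<forall>k\<ge>K. homeo_dist (\<sigma> k) f < \<epsilon>" if pos: "\<epsilon> > 0" for \<epsilon> :: real
  proof -
    obtain n where n: "1 / real (Suc n) < \<epsilon>" using pos by (rule nat_approx_posE)
    obtain K :: nat where K: "\<forall>k\<ge>K. \<forall>x. agree (Suc n) (\<sigma> k x) (f x)" using f by blast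
    obtain K' :: nat where K': "\<forall>k\<ge>K'. \<forall>x. agree (Suc n) (?\<tau> k x) (g x)" using g by blast
    have "homeo_dist (\<sigma> k) f < 1 / real (Suc n)" if "max K K' \<le> k" for k
      using that K K' unfolding homeo_dist_less_iff_agree inv by simp
    then show ?thesis using n less_trans by blast
  qed
  then have "limitin Polish.mtopology \<sigma> f sequentially"
    unfolding Polish.limit_metric_sequentially using f_car car by simp
  then show "\<exists>f. limitin Polish.mtopology \<sigma> f sequentially" by (intro exI[of _ f])
qed

lemma completely_metrizable_homeo: "completely_metrizable_space Homeo.mtopology"
  unfolding completely_metrizable_space_def
  using Polish.Metric_space_axioms Polish_mcomplete Polish_mtopology by metis

section \<open>The comeager conjugacy class\<close>

text \<open>
  For density, approximating to a higher precision than required also makes the index \<open>N\<close> of the split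
  as large as desired; this is the reason for the existential quantifier over \<open>N\<close>.
\<close>

lemma splits_open_dense:
  defines "S \<equiv> \<lambda>n. {h \<in> carrier cantor_homeo_group. \<exists>N\<ge>n. one_way_split N h}"
  shows "openin Homeo.mtopology (S n)" "Homeo.mtopology closure_of S n = carrier cantor_homeo_group"
proof -
  show "openin Homeo.mtopology (S n)"
    unfolding Homeo.openin_mtopology
  proof (intro conjI allI impI)
    fix h assume "h \<in> S n"
    then obtain N where h: "N \<ge> n" "one_way_split N h" by (auto simp: S_def)
    obtain m where m: "\<And>g. (\<And>x. agree m (h x) (g x)) \<Longrightarrow> one_way_split N g"
      using one_way_split_stable[OF h(2)] by metis
    have "Homeo.mball h (1 / real (Suc m)) \<subseteq> S n"
    proof
      fix g assume "g \<in> Homeo.mball h (1 / real (Suc m))"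
      then have g: "g \<in> carrier cantor_homeo_group" and "cantor_sup_dist h g < 1 / real (Suc m)"
        unfolding Homeo.in_mball by blast+
      then have hg: "\<And>x. agree (Suc m) (h x) (g x)" unfolding cantor_sup_dist_less_iff_agree by blast
      have "one_way_split N g" by (rule m, rule agree_mono[OF hg]) simp
      then show "g \<in> S n" using g h(1) by (auto simp: S_def)
    qed
    then show "\<exists>r>0. Homeo.mball h r \<subseteq> S n" by (intro exI[of _ "1 / real (Suc m)"]) simp
  qed (auto simp: S_def)
  show "Homeo.mtopology closure_of S n = carrier cantor_homeo_group"
  proof (rule equalityI)
    show "carrier cantor_homeo_group \<subseteq> Homeo.mtopology closure_of S n"
    proof
      fix h assume h: "h \<in> carrier cantor_homeo_group"
      have "\<exists>g\<in>S n. g \<in> Homeo.mball h r" if r: "r > 0" for r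
      proof -
        obtain k where k: "1 / real (Suc k) < r" using r by (rule nat_approx_posE)
        obtain g where g: "g \<in> carrier cantor_homeo_group" "\<And>x. agree (Suc (max k n)) (h x) (g x)"
          "one_way_split (Suc (max k n)) g"
          using one_way_split_dense[OF h] by metis
        have "agree (Suc k) (h x) (g x)" for x by (rule agree_mono[OF g(2)]) simp
        then have "cantor_sup_dist h g < 1 / real (Suc k)" unfolding cantor_sup_dist_less_iff_agree ..
        then have "g \<in> Homeo.mball h r" using h g(1) k by simp
        moreover have "n \<le> Suc (max k n)" by simp
        ultimately show ?thesis using g(1,3) unfolding S_def by blast
      qed
      then show "h \<in> Homeo.mtopology closure_of S n"
        using h unfolding Homeo.metric_closure_of by blast
    qed
  qed (use closure_of_subset_topspace[of Homeo.mtopology "S n"] in simp)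
qed

text \<open>
  A comeager set contains the intersection of the dense open complements of the closures of the
  nowhere dense sets that make up its complement, to which the Baire category theorem applies
  together with \<open>S\<close>.
\<close>

lemma comeager_meets_open_dense:
  assumes X: "completely_metrizable_space X" "topspace X \<noteq> {}" and C: "comeager_in X C"
    and S: "\<And>n :: nat. openin X (S n)" "\<And>n. X closure_of (S n) = topspace X"
  shows "C \<inter> (\<Inter>n. S n) \<noteq> {}"
proof -
  obtain N :: "nat \<Rightarrow> 'a set" where N: "\<And>n. nowhere_dense_in X (N n)" "topspace X - C = (\<Union>n. N n)"
    using C unfolding comeager_in_def meager_in_def by blast
  let ?V = "\<lambda>n. topspace X - X closure_of N n"
  have "X closure_of \<Inter>(range ?V \<union> range S) = topspace X"
  proof (rule Baire_category)
    fix T assume "T \<in> range ?V \<union> range S"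
    then show "openin X T \<and> X closure_of T = topspace X"
    proof
      assume "T \<in> range ?V"
      then obtain n where T: "T = ?V n" by blast
      have "X interior_of (X closure_of N n) = {}" using N(1) by (simp add: nowhere_dense_in_def)
      then show ?thesis unfolding T by (simp add: closure_of_complement openin_diff)
    qed (use S in blast)
  qed (use X in auto)
  then have "\<Inter>(range ?V \<union> range S) \<noteq> {}" using X(2) by force
  then obtain h where hh: "h \<in> \<Inter>(range ?V \<union> range S)" unfolding ex_in_conv[symmetric] ..
  have h: "h \<in> ?V n" "h \<in> S n" for n by (rule InterD[OF hh]; blast)+
  have "h \<notin> N n" for n
    using h(1)[of n] N(1)[of n] closure_of_subset[of "N n" X] unfolding nowhere_dense_in_def by blast
  moreover have "h \<in> topspace X" using h(1) by blast
  ultimately have "h \<in> C" using N(2) by blast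
  then show ?thesis using h(2) by blast
qed

theorem theorem4p3:
  fixes C :: "((nat \<Rightarrow> bool) \<Rightarrow> (nat \<Rightarrow> bool)) set"
    and h :: "(nat \<Rightarrow> bool) \<Rightarrow> (nat \<Rightarrow> bool)"
  assumes "C \<in> conjugacy_classes cantor_homeo_group"
    and "comeager_in Homeo.mtopology C"
    and "h \<in> C"
  shows "Cantor.shadowing_property h"
proof -
  interpret group cantor_homeo_group by (rule group_cantor_homeo_group)
  have "topspace Homeo.mtopology \<noteq> {}"
    unfolding Homeo.topspace_mtopology using one_closed by blast
  moreover have "Homeo.mtopology closure_of {h \<in> carrier cantor_homeo_group. \<exists>N\<ge>n. one_way_split N h} =
      topspace Homeo.mtopology" for n
    unfolding Homeo.topspace_mtopology by (rule splits_open_dense(2))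
  ultimately have "C \<inter> (\<Inter>n. {h \<in> carrier cantor_homeo_group. \<exists>N\<ge>n. one_way_split N h}) \<noteq> {}"
    using splits_open_dense(1) completely_metrizable_homeo assms(2)
    by (intro comeager_meets_open_dense)
  then obtain f where f: "f \<in> C" "f \<in> carrier cantor_homeo_group" "\<And>n. \<exists>N\<ge>n. one_way_split N f"
    by blast
  have "Cantor.shadowing_property f" using f(2,3) by (rule shadowing_if_one_way_splits)
  obtain a where a: "a \<in> carrier cantor_homeo_group"
    "C = {k \<otimes>\<^bsub>cantor_homeo_group\<^esub> a \<otimes>\<^bsub>cantor_homeo_group\<^esub> inv\<^bsub>cantor_homeo_group\<^esub> k | k. k \<in> carrier cantor_homeo_group}"
    using assms(1) unfolding conjugacy_classes_def by blast
  have conj: "\<exists>k\<in>carrier cantor_homeo_group. g = k \<circ> a \<circ> inv_into UNIV k" if "g \<in> C" for g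
    using that homeo_group_inv unfolding a(2) by (auto simp: cantor_homeo_group_def)
  obtain k where k: "k \<in> carrier cantor_homeo_group" "f = k \<circ> a \<circ> inv_into UNIV k" using conj[OF f(1)] by blast
  obtain l where l: "l \<in> carrier cantor_homeo_group" "h = l \<circ> a \<circ> inv_into UNIV l" using conj[OF assms(3)] by blast
  have "inv_into UNIV (inv_into UNIV k) = k"
    using k(1) by (simp add: carrier_cantor_homeo_group inv_inv_eq)
  then have "inv_into UNIV k \<circ> f \<circ> inv_into UNIV (inv_into UNIV k) = a"
    unfolding k(2) comp_def by (simp only: homeo_inv[OF k(1)])
  then have "Cantor.shadowing_property a"
    using shadowing_conjugate[OF f(2) homeo_inv_closed[OF k(1)]] \<open>Cantor.shadowing_property f\<close>
    by simp
  then show ?thesis unfolding l(2) by (rule shadowing_conjugate[OF a(1) l(1)])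
qed

end
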